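(* Let $n\ge1$ and let $f=(f_1,\dots,f_n):\mathbb{R}^2\to\mathbb{R}^n$ be a $C^2$ map whose graph $\Sigma=\{(x,y,f_1(x,y),\dots,f_n(x,y)):(x,y)\in\mathbb{R}^2\}$ is a minimal surface in $\mathbb{R}^{n+2}$. (a) Suppose that, for each $k\in\{1,\dots,n\}$, one of the four inequalities $$\frac{\partial f_k}{\partial x}>0,\qquad \frac{\partial f_k}{\partial x}<0,\qquad \frac{\partial f_k}{\partial y}>0,\qquad \frac{\partial f_k}{\partial y}<0$$ holds on the whole plane $\mathbb{R}^2$. Then $\Sigma$ is a plane. (b) Suppose that, for some fixed $k\in\{1,\dots,n\}$, either $\frac{\partial f_k}{\partial x}$ or $\frac{\partial f_k}{\partial y}$ is a non-zero constant function on the whole plane $\mathbb{R}^2$. Then $f_k$ is an affine function.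
   Context: $\mathbb{R}^{n+2}$ carries the Euclidean metric. The graph of $f$ is minimal (zero mean curvature) if and only if $G\,\partial_{xx}f_k-2F\,\partial_{xy}f_k+E\,\partial_{yy}f_k=0$ for $k=1,\dots,n$, where $E=1+\sum_k(\partial_x f_k)^2$, $F=\sum_k\partial_x f_k\,\partial_y f_k$, $G=1+\sum_k(\partial_y f_k)^2$. *)

theory Defs
  imports "HOL-Analysis.Analysis"
begin

definition C1_map :: "('a::real_normed_vector \<Rightarrow> 'b::real_normed_vector) \<Rightarrow> bool" where
  "C1_map f \<longleftrightarrow> (\<exists>f' :: 'a \<Rightarrow> 'a \<Rightarrow>\<^sub>L 'b.
     (\<forall>p. (f has_derivative blinfun_apply (f' p)) (at p)) \<and> continuous_on UNIV f')"

definition C2_map :: "('a::real_normed_vector \<Rightarrow> 'b::real_normed_vector) \<Rightarrow> bool" where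
  "C2_map f \<longleftrightarrow> (\<exists>f' :: 'a \<Rightarrow> 'a \<Rightarrow>\<^sub>L 'b.
     (\<forall>p. (f has_derivative blinfun_apply (f' p)) (at p)) \<and> C1_map f')"

definition partial_x :: "(real \<times> real \<Rightarrow> 'e::real_normed_vector) \<Rightarrow> real \<times> real \<Rightarrow> 'e" where
  "partial_x X p = vector_derivative (\<lambda>t. X (t, snd p)) (at (fst p))"

definition partial_y :: "(real \<times> real \<Rightarrow> 'e::real_normed_vector) \<Rightarrow> real \<times> real \<Rightarrow> 'e" where
  "partial_y X p = vector_derivative (\<lambda>t. X (fst p, t)) (at (snd p))"

text \<open>The remaining definitions concern a parametrized surface X in a Euclidean space 'e
  of arbitrary dimension.\<close>

definition tangent_space :: "(real \<times> real \<Rightarrow> 'e::euclidean_space) \<Rightarrow> real \<times> real \<Rightarrow> 'e set" where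
  "tangent_space X p = span {partial_x X p, partial_y X p}"

definition normal_part :: "(real \<times> real \<Rightarrow> 'e::euclidean_space) \<Rightarrow> real \<times> real \<Rightarrow> 'e \<Rightarrow> 'e" where
  "normal_part X p v =
     (THE w. w \<in> (tangent_space X p)\<^sup>\<bottom> \<and> v - w \<in> tangent_space X p)"

text \<open>Half the trace, with respect to the first fundamental form (E, F, G), of the vector-valued
  second fundamental form, whose coefficients (L, M, N) are the normal parts of the second
  derivatives of X.\<close>

definition mean_curvature_vector ::
    "(real \<times> real \<Rightarrow> 'e::euclidean_space) \<Rightarrow> real \<times> real \<Rightarrow> 'e" where
  "mean_curvature_vector X p =
    (let E = partial_x X p \<bullet> partial_x X p;
         F = partial_x X p \<bullet> partial_y X p;
         G = partial_y X p \<bullet> partial_y X p;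
         L = normal_part X p (partial_x (partial_x X) p);
         M = normal_part X p (partial_x (partial_y X) p);
         N = normal_part X p (partial_y (partial_y X) p)
     in (1 / (2 * (E * G - F\<^sup>2))) *\<^sub>R (G *\<^sub>R L - (2 * F) *\<^sub>R M + E *\<^sub>R N))"

definition minimal_surface :: "(real \<times> real \<Rightarrow> 'e::euclidean_space) \<Rightarrow> bool" where
  "minimal_surface X \<longleftrightarrow> (\<forall>p. mean_curvature_vector X p = 0)"

text \<open>The target type carries the product inner product, so for a map into \<open>real ^ 'n\<close> with
  \<open>CARD('n) = n\<close> it is Euclidean space of dimension n + 2.\<close>

definition graph_map :: "(real \<times> real \<Rightarrow> 'e) \<Rightarrow> real \<times> real \<Rightarrow> (real \<times> real) \<times> 'e" where
  "graph_map f p = (p, f p)"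

definition is_plane :: "'e::euclidean_space set \<Rightarrow> bool" where
  "is_plane S \<longleftrightarrow> affine S \<and> aff_dim S = 2"

definition affine_function :: "(real \<times> real \<Rightarrow> real) \<Rightarrow> bool" where
  "affine_function g \<longleftrightarrow> (\<exists>a b c. \<forall>x y. g (x, y) = a * x + b * y + c)"

end

theory Submission
  imports Defs "HOL-Complex_Analysis.Great_Picard"
begin

text \<open>Write \<open>W = sqrt (E G - F\<^sup>2)\<close>. The minimal surface equation makes the symmetric matrix
  with entries \<open>E/W\<close>, \<open>F/W\<close>, \<open>G/W\<close>, which has determinant 1, the Jacobian of a map
  \<open>(M, N)\<close> of the plane. As in the classical proof of Joergens' theorem, Lewy's map
  \<open>(x, y) \<mapsto> (x + M) + \<i> (y + N)\<close> is expansive, hence a diffeomorphism onto the complex plane,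
  and in this coordinate \<open>(x - M) - \<i> (y - N)\<close> is an entire function whose derivative is bounded
  by 1. By Liouville's theorem the derivative, and with it the matrix, is constant. The minimal
  surface equation thus has constant coefficients, so after a linear change of coordinates every
  component of \<open>f\<close> is harmonic on the whole plane. Its complex gradient is entire, and if a partial
  derivative omits a value, the complex gradient omits a line and is constant by Picard's theorem.\<close>

section \<open>Symmetry of second derivatives and the Poincare lemma in the plane\<close>

text \<open>The mean value theorem is applied twice, first in \<open>x\<close> to the difference of
  \<open>U\<close> across the strip of height \<open>h\<close>, then in \<open>y\<close> to
  \<open>P \<xi>\<close>. Exchanging the variables keeps the second difference, so it can be
  compared with both mixed derivatives.\<close>

lemma second_difference_mean_value:
  fixes U :: "real \<Rightarrow> real \<Rightarrow> real"
  assumes U: "\<And>x y. ((\<lambda>x. U x y) has_real_derivative P x y) (at x)"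
    and P: "\<And>x y. ((\<lambda>y. P x y) has_real_derivative S x y) (at y)"
    and h: "h > 0"
  obtains \<xi> \<eta> where "x < \<xi>" "\<xi> < x + h" "y < \<eta>" "\<eta> < y + h"
    "U (x + h) (y + h) - U (x + h) y - U x (y + h) + U x y = h * h * S \<xi> \<eta>"
proof -
  have "\<exists>\<xi>. x < \<xi> \<and> \<xi> < x + h \<and> (U (x + h) (y + h) - U (x + h) y) - (U x (y + h) - U x y)
      = (x + h - x) * (P \<xi> (y + h) - P \<xi> y)"
    using h by (intro MVT2) (auto intro!: derivative_intros U)
  then obtain \<xi> where \<xi>: "x < \<xi>" "\<xi> < x + h"
    "(U (x + h) (y + h) - U (x + h) y) - (U x (y + h) - U x y) = h * (P \<xi> (y + h) - P \<xi> y)"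
    by auto
  have "\<exists>\<eta>. y < \<eta> \<and> \<eta> < y + h \<and> P \<xi> (y + h) - P \<xi> y = (y + h - y) * S \<xi> \<eta>"
    using h by (intro MVT2) (auto intro!: P)
  then show thesis
    using \<xi> that by (auto simp: algebra_simps)
qed

text \<open>Schwarz's theorem. One second difference over a small square equals \<open>h * h\<close>
  times a value of \<open>s\<close> and also \<open>h * h\<close> times a value of
  \<open>s'\<close>; by continuity these values are close to those at \<open>z\<close>.\<close>

lemma mixed_partials_eq:
  fixes u :: "real \<times> real \<Rightarrow> real"
  assumes u: "\<And>z. (u has_derivative (\<lambda>h. fst h * p z + snd h * q z)) (at z)"
    and p: "\<And>z. (p has_derivative (\<lambda>h. fst h * r z + snd h * s z)) (at z)"
    and q: "\<And>z. (q has_derivative (\<lambda>h. fst h * s' z + snd h * t z)) (at z)"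
    and s: "continuous_on UNIV s" and s': "continuous_on UNIV s'"
  shows "s z = s' z"
proof (rule ccontr)
  assume ne: "s z \<noteq> s' z"
  obtain x y where z: "z = (x, y)" by fastforce
  \<comment> \<open>Half the gap: numbers closer than this to \<open>s z\<close> and to
    \<open>s' z\<close> respectively cannot coincide.\<close>
  define \<epsilon> where "\<epsilon> = \<bar>s z - s' z\<bar> / 2"
  have \<epsilon>: "\<epsilon> > 0" using ne by (simp add: \<epsilon>_def)
  obtain d where d: "d > 0" "\<And>z'. dist z' z < d \<Longrightarrow> dist (s z') (s z) < \<epsilon>"
    using s \<epsilon> unfolding continuous_on_iff by blast
  obtain d' where d': "d' > 0" "\<And>z'. dist z' z < d' \<Longrightarrow> dist (s' z') (s' z) < \<epsilon>"
    using s' \<epsilon> unfolding continuous_on_iff by blast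
  define h where "h = min d d' / 2"
  have h: "h > 0" "2 * h \<le> d" "2 * h \<le> d'" using d d' by (auto simp: h_def)
  have near: "dist (\<xi>, \<eta>) z < 2 * h" if "x < \<xi>" "\<xi> < x + h" "y < \<eta>" "\<eta> < y + h" for \<xi> \<eta>
    using that real_sqrt_sum_squares_triangle_ineq[of "\<xi> - x" 0 0 "\<eta> - y"]
    by (simp add: z dist_Pair_Pair dist_real_def)
  have along_x: "((\<lambda>x. v (x, y)) has_real_derivative vx (x, y)) (at x)"
    if "\<And>z. (v has_derivative (\<lambda>h. fst h * vx z + snd h * vy z)) (at z)"
    for v vx vy :: "real \<times> real \<Rightarrow> real" and x y
    unfolding has_field_derivative_def
    by (rule has_derivative_eq_rhs,
        rule has_derivative_compose[of "\<lambda>x. (x, y)" "\<lambda>h. (h, 0)" x UNIV v, OF _ that])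
       (auto intro!: derivative_eq_intros)
  have along_y: "((\<lambda>y. v (x, y)) has_real_derivative vy (x, y)) (at y)"
    if "\<And>z. (v has_derivative (\<lambda>h. fst h * vx z + snd h * vy z)) (at z)"
    for v vx vy :: "real \<times> real \<Rightarrow> real" and x y
    unfolding has_field_derivative_def
    by (rule has_derivative_eq_rhs,
        rule has_derivative_compose[of "\<lambda>y. (x, y)" "\<lambda>h. (0, h)" y UNIV v, OF _ that])
       (auto intro!: derivative_eq_intros)
  obtain \<xi> \<eta> where 1: "x < \<xi>" "\<xi> < x + h" "y < \<eta>" "\<eta> < y + h"
    "u (x + h, y + h) - u (x + h, y) - u (x, y + h) + u (x, y) = h * h * s (\<xi>, \<eta>)"
    by (rule second_difference_mean_value[of "\<lambda>x y. u (x, y)" "\<lambda>x y. p (x, y)"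
          "\<lambda>x y. s (x, y)" h x y, OF along_x[OF u] along_y[OF p] h(1)])
  obtain \<eta>' \<xi>' where 2: "y < \<eta>'" "\<eta>' < y + h" "x < \<xi>'" "\<xi>' < x + h"
    "u (x + h, y + h) - u (x, y + h) - u (x + h, y) + u (x, y) = h * h * s' (\<xi>', \<eta>')"
    by (rule second_difference_mean_value[of "\<lambda>y x. u (x, y)" "\<lambda>y x. q (x, y)"
          "\<lambda>y x. s' (x, y)" h y x, OF along_y[OF u] along_x[OF q] h(1)])
  have "h * h * s (\<xi>, \<eta>) = h * h * s' (\<xi>', \<eta>')"
    using 1(5) 2(5) by linarith
  then have "s (\<xi>, \<eta>) = s' (\<xi>', \<eta>')" using h by simp
  moreover have "dist (s (\<xi>, \<eta>)) (s z) < \<epsilon>" "dist (s' (\<xi>', \<eta>')) (s' z) < \<epsilon>"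
    using d(2)[of "(\<xi>, \<eta>)"] d'(2)[of "(\<xi>', \<eta>')"] near[OF 1(1-4)] near[OF 2(3,4,1,2)] h
    by linarith+
  ultimately show False
    by (simp add: \<epsilon>_def dist_real_def abs_if split: if_splits)
qed

text \<open>Because \<open>a\<close> and \<open>b\<close> share the cross derivative
  \<open>c\<close>, the form \<open>a dx + b dy\<close> is closed. Its potential is the integral
  along the segment from the origin, differentiated under the integral sign.\<close>

lemma closed_form_exact:
  fixes a b :: "real \<times> real \<Rightarrow> real"
  assumes a: "\<And>z. (a has_derivative (\<lambda>h. fst h * ax z + snd h * c z)) (at z)"
    and b: "\<And>z. (b has_derivative (\<lambda>h. fst h * c z + snd h * by z)) (at z)"
    and cont: "continuous_on UNIV ax" "continuous_on UNIV c" "continuous_on UNIV by"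
  obtains M where "\<And>z. (M has_derivative (\<lambda>h. fst h * a z + snd h * b z)) (at z)"
proof
  fix z :: "real \<times> real"
  note comp = has_derivative_compose[OF _ a] has_derivative_compose[OF _ b]
  have conta: "continuous_on S a" and contb: "continuous_on S b" for S
    using a b by (meson has_derivative_continuous continuous_at_imp_continuous_on)+
  note cont' = conta contb cont
  have [continuous_intros]:
    "continuous_on S (\<lambda>x. a (k x))" "continuous_on S (\<lambda>x. b (k x))"
    "continuous_on S (\<lambda>x. ax (k x))" "continuous_on S (\<lambda>x. by (k x))"
    "continuous_on S (\<lambda>x. c (k x))"
    if "continuous_on S k" for S :: "'z::topological_space set" and k
    using that by (auto intro: continuous_on_compose2[OF cont'(1)] continuous_on_compose2[OF cont'(2)]
        continuous_on_compose2[OF cont'(3)] continuous_on_compose2[OF cont'(4)]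
        continuous_on_compose2[OF cont'(5)])
  \<comment> \<open>\<open>A x t\<close> is at once the derivative of
    \<open>t * a (t *\<^sub>R x)\<close> in \<open>t\<close> and, thanks to the common
    \<open>c\<close>, the first partial derivative at \<open>x\<close> of the integrand of the
    potential; likewise \<open>B\<close> for \<open>b\<close> and the second partial derivative.
    Integrating over \<open>t\<close> therefore returns \<open>a\<close> and
    \<open>b\<close>.\<close>
  define A where "A x t = a (t *\<^sub>R x) + t * (fst x * ax (t *\<^sub>R x) + snd x * c (t *\<^sub>R x))"
    for x :: "real \<times> real" and t
  define B where "B x t = b (t *\<^sub>R x) + t * (fst x * c (t *\<^sub>R x) + snd x * by (t *\<^sub>R x))"
    for x :: "real \<times> real" and t
  define D :: "real \<times> real \<Rightarrow> real \<Rightarrow> (real \<times> real) \<Rightarrow>\<^sub>L real"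
    where "D x t = A x t *\<^sub>R fst_blinfun + B x t *\<^sub>R snd_blinfun" for x t
  have "((\<lambda>t. t * a (t *\<^sub>R z)) has_vector_derivative A z t) (at t within {0..1})" for t
    unfolding has_vector_derivative_def A_def
    by (rule has_derivative_eq_rhs, (rule derivative_intros comp)+) (auto simp: algebra_simps)
  then have A: "(A z has_integral a z) {0..1}"
    using fundamental_theorem_of_calculus[of 0 1 "\<lambda>t. t * a (t *\<^sub>R z)" "A z"] by simp
  have "((\<lambda>t. t * b (t *\<^sub>R z)) has_vector_derivative B z t) (at t within {0..1})" for t
    unfolding has_vector_derivative_def B_def
    by (rule has_derivative_eq_rhs, (rule derivative_intros comp)+) (auto simp: algebra_simps)
  then have B: "(B z has_integral b z) {0..1}"
    using fundamental_theorem_of_calculus[of 0 1 "\<lambda>t. t * b (t *\<^sub>R z)" "B z"] by simp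
  have D: "integral (cbox 0 1) (D z) = a z *\<^sub>R fst_blinfun + b z *\<^sub>R snd_blinfun"
    unfolding D_def
    using has_integral_add[OF has_integral_linear[OF A bounded_linear_scaleR_left, of fst_blinfun]
      has_integral_linear[OF B bounded_linear_scaleR_left, of snd_blinfun]]
    by (auto simp: o_def)
  have "((\<lambda>z. integral (cbox 0 1) (\<lambda>t. fst z * a (t *\<^sub>R z) + snd z * b (t *\<^sub>R z)))
     has_derivative integral (cbox 0 1) (D z)) (at z within UNIV)"
  proof (rule leibniz_rule)
    fix x :: "real \<times> real" and t :: real
    show "((\<lambda>x. fst x * a (t *\<^sub>R x) + snd x * b (t *\<^sub>R x)) has_derivative D x t) (at x within UNIV)"
      unfolding D_def A_def B_def
      by (rule has_derivative_eq_rhs, (rule derivative_intros comp)+)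
         (auto simp: algebra_simps blinfun.bilinear_simps)
  next
    fix x :: "real \<times> real"
    show "(\<lambda>t. fst x * a (t *\<^sub>R x) + snd x * b (t *\<^sub>R x)) integrable_on cbox 0 1"
      by (intro integrable_continuous continuous_intros)
  next
    show "continuous_on (UNIV \<times> cbox 0 1) (\<lambda>(x, t). D x t)"
      unfolding D_def A_def B_def case_prod_unfold by (intro continuous_intros)
  qed auto
  then show "((\<lambda>z. integral (cbox 0 1) (\<lambda>t. fst z * a (t *\<^sub>R z) + snd z * b (t *\<^sub>R z)))
     has_derivative (\<lambda>h. fst h * a z + snd h * b z)) (at z)"
    unfolding D by (rule has_derivative_eq_rhs) (auto simp: blinfun.bilinear_simps)
qed

section \<open>Bijectivity of expansive maps\<close>

text \<open>Expansiveness pulls a Cauchy sequence of images back to a Cauchy sequence of preimages,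
  which converges by completeness.\<close>

lemma expansive_closed_range:
  fixes T :: "'a::complete_space \<Rightarrow> 'b::metric_space"
  assumes "continuous_on UNIV T" and exp: "\<And>x y. dist x y \<le> dist (T x) (T y)"
  shows "closed (range T)"
  unfolding closed_sequential_limits
proof (intro allI impI, elim conjE)
  fix X l assume X: "\<forall>n. X n \<in> range T" "X \<longlonglongrightarrow> l"
  then have "\<forall>n. \<exists>y. X n = T y" by blast
  then obtain x where x: "\<And>n. X n = T (x n)" by metis
  have "Cauchy X" using X by (simp add: LIMSEQ_imp_Cauchy)
  then have "Cauchy x"
    unfolding Cauchy_def x by (meson exp le_less_trans)
  then obtain l' where "x \<longlonglongrightarrow> l'" using Cauchy_convergent convergent_def by blast
  then have "X \<longlonglongrightarrow> T l'"
    using assms(1) unfolding x by (auto intro: continuous_on_tendsto_compose)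
  then show "l \<in> range T" using X LIMSEQ_unique by blast
qed

text \<open>An expansive map is injective, so by invariance of domain its range is open; the range
  is also closed, hence the whole connected space.\<close>

lemma expansive_bij:
  fixes T :: "'a::euclidean_space \<Rightarrow> 'b::euclidean_space"
  assumes T: "continuous_on UNIV T" and exp: "\<And>x y. dist x y \<le> dist (T x) (T y)"
    and "DIM('b) \<le> DIM('a)"
  shows "bij T"
proof -
  have inj: "inj T"
    by (rule injI) (metis exp dist_self dist_le_zero_iff)
  moreover have "open (range T)"
    using invariance_of_domain_gen[OF open_UNIV T inj] assms(3) by simp
  then have "range T = UNIV"
    using expansive_closed_range[OF T exp] clopen[of "range T"] by auto
  ultimately show ?thesis by (simp add: bij_def)
qed

section \<open>Joergens' theorem by Lewy's transformation\<close>

text \<open>This is the monotonicity of the gradient of a convex function: the derivative along a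
  segment is the quadratic form with entries \<open>e\<close>, \<open>f\<close>, \<open>g\<close>,
  which is nonnegative.\<close>

lemma positive_definite_gradient_monotone:
  fixes M N e f g :: "real \<times> real \<Rightarrow> real"
  assumes M: "\<And>z. (M has_derivative (\<lambda>h. fst h * e z + snd h * f z)) (at z)"
    and N: "\<And>z. (N has_derivative (\<lambda>h. fst h * f z + snd h * g z)) (at z)"
    and pos: "\<And>z. e z > 0" and det: "\<And>z. e z * g z - (f z)\<^sup>2 \<ge> 0"
  shows "0 \<le> (M w - M z) * (fst w - fst z) + (N w - N z) * (snd w - snd z)"
proof -
  define d where "d = w - z"
  define m where "m t = M (z + t *\<^sub>R d) * fst d + N (z + t *\<^sub>R d) * snd d" for t
  define m' where "m' t = (let p = z + t *\<^sub>R d in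
      e p * (fst d)\<^sup>2 + 2 * f p * fst d * snd d + g p * (snd d)\<^sup>2)" for t
  note comp = has_derivative_compose[OF _ M] has_derivative_compose[OF _ N]
  have "(m has_real_derivative m' t) (at t)" for t
    unfolding m_def m'_def has_field_derivative_def Let_def
    by (rule has_derivative_eq_rhs, (rule derivative_intros comp)+)
       (auto simp: algebra_simps power2_eq_square)
  moreover have "0 \<le> m' t" for t
  proof -
    let ?p = "z + t *\<^sub>R d"
    \<comment> \<open>Completing the square, after multiplication by the positive number
      \<open>e ?p\<close>.\<close>
    have "e ?p * m' t = (e ?p * fst d + f ?p * snd d)\<^sup>2 + (e ?p * g ?p - (f ?p)\<^sup>2) * (snd d)\<^sup>2"
      by (simp add: m'_def Let_def algebra_simps power2_eq_square)
    also have "\<dots> \<ge> 0" using det[of ?p] by simp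
    finally show ?thesis using pos[of ?p] by (simp add: zero_le_mult_iff not_less)
  qed
  ultimately have "m 0 \<le> m 1"
    by (intro DERIV_nonneg_imp_nondecreasing[of 0 1 m]) auto
  then show ?thesis
    by (simp add: m_def d_def algebra_simps)
qed

text \<open>The shared derivatives \<open>c\<close> and \<open>d\<close> make \<open>e\<close>,
  \<open>f\<close>, \<open>g\<close> the entries of the Hessian of a function on the plane, and
  \<open>det\<close> is the Monge-Ampere equation for it. Joergens' theorem says that this function
  is a quadratic polynomial.\<close>

lemma entire_unimodular_hessian_constant:
  fixes e f g :: "real \<times> real \<Rightarrow> real"
  assumes e: "\<And>z. (e has_derivative (\<lambda>h. fst h * ex z + snd h * c z)) (at z)"
    and f: "\<And>z. (f has_derivative (\<lambda>h. fst h * c z + snd h * d z)) (at z)"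
    and g: "\<And>z. (g has_derivative (\<lambda>h. fst h * d z + snd h * gy z)) (at z)"
    and cont: "continuous_on UNIV ex" "continuous_on UNIV c" "continuous_on UNIV d"
      "continuous_on UNIV gy"
    and pos: "\<And>z. e z > 0" and det: "\<And>z. e z * g z - (f z)\<^sup>2 = 1"
  obtains e0 f0 g0 where "\<And>z. e z = e0" "\<And>z. f z = f0" "\<And>z. g z = g0"
proof -
  obtain M where M: "\<And>z. (M has_derivative (\<lambda>h. fst h * e z + snd h * f z)) (at z)"
    using closed_form_exact[OF e f cont(1-3)] by blast
  obtain N where N: "\<And>z. (N has_derivative (\<lambda>h. fst h * f z + snd h * g z)) (at z)"
    using closed_form_exact[OF f g cont(2-4)] by blast
  have gpos: "g z > 0" for z
  proof -
    have "e z * g z > 0" using det[of z] by (smt (verit) zero_le_power2)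
    then show ?thesis using pos[of z] by (simp add: zero_less_mult_iff)
  qed
  define T where "T z = complex_of_real (fst z + M z) + \<i> * complex_of_real (snd z + N z)" for z
  define T' where "T' z h = complex_of_real (fst h + (fst h * e z + snd h * f z)) +
    \<i> * complex_of_real (snd h + (fst h * f z + snd h * g z))" for z and h :: "real \<times> real"
  define H where "H z = complex_of_real (fst z - M z) + \<i> * complex_of_real (N z - snd z)" for z
  define H' where "H' z h = complex_of_real (fst h - (fst h * e z + snd h * f z)) +
    \<i> * complex_of_real ((fst h * f z + snd h * g z) - snd h)" for z and h :: "real \<times> real"
  have T: "(T has_derivative T' z) (at z)" for z
    unfolding T_def T'_def
    by (rule has_derivative_eq_rhs, (rule derivative_intros M N)+) (auto simp: fun_eq_iff)
  have H: "(H has_derivative H' z) (at z)" for z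
    unfolding H_def H'_def
    by (rule has_derivative_eq_rhs, (rule derivative_intros M N)+) (auto simp: fun_eq_iff)
  have contT: "continuous_on UNIV T"
    using T by (meson has_derivative_continuous continuous_at_imp_continuous_on)
  have expT: "dist w z \<le> dist (T w) (T z)" for w z
  proof -
    define a b m n where "a = fst w - fst z" "b = snd w - snd z" "m = M w - M z" "n = N w - N z"
    note defs = this
    have "0 \<le> m * a + n * b"
      using positive_definite_gradient_monotone[OF M N pos, of w z] det by (simp add: defs)
    \<comment> \<open>The right-hand side exceeds the left by \<open>m\<^sup>2 + n\<^sup>2\<close>
      and twice the nonnegative \<open>m * a + n * b\<close>.\<close>
    then have "a\<^sup>2 + b\<^sup>2 \<le> (a + m)\<^sup>2 + (b + n)\<^sup>2"
      by (simp add: power2_sum algebra_simps)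
    moreover have "dist w z = sqrt (a\<^sup>2 + b\<^sup>2)"
      by (simp add: dist_prod_def dist_real_def defs)
    moreover have "dist (T w) (T z) = sqrt ((a + m)\<^sup>2 + (b + n)\<^sup>2)"
      by (simp add: dist_norm cmod_def T_def defs algebra_simps)
    ultimately show ?thesis by simp
  qed
  have bij: "bij T" by (rule expansive_bij[OF contT expT]) simp
  define G where "G = inv T"
  have TG: "T (G \<zeta>) = \<zeta>" for \<zeta> using bij by (simp add: G_def surj_f_inv_f bij_is_surj)
  \<comment> \<open>Since \<open>T\<close> is expansive, \<open>G\<close> does not increase
    distances, so \<delta> = \<epsilon> works.\<close>
  have contG: "isCont G \<zeta>" for \<zeta>
    unfolding continuous_at_eps_delta
    by (metis TG expT order_le_less_trans)
  \<comment> \<open>\<open>S z\<close> is the determinant of \<open>T' z\<close>, simplified by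
    \<open>det\<close>; \<open>G'\<close> below inverts \<open>T'\<close> by Cramer's rule.\<close>
  define S where "S z = 2 + e z + g z" for z
  have S: "S z > 0" for z using pos[of z] gpos[of z] by (simp add: S_def)
  define G' where "G' z \<zeta> = (((1 + g z) * Re \<zeta> - f z * Im \<zeta>) / S z, ((1 + e z) * Im \<zeta> - f z * Re \<zeta>) / S z)"
    for z \<zeta>
  have SD: "S z = (1 + e z) * (1 + g z) - (f z)\<^sup>2" for z
    using det[of z] by (simp add: S_def algebra_simps)
  have G: "(G has_derivative G' (G \<zeta>)) (at \<zeta>)" for \<zeta>
  proof (rule has_derivative_inverse_basic[OF T _ _ contG open_UNIV UNIV_I TG])
    let ?z = "G \<zeta>"
    show "bounded_linear (G' ?z)"
      unfolding G'_def
      by (intro bounded_linear_Pair bounded_linear_divide[THEN bounded_linear_compose]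
          bounded_linear_sub bounded_linear_mult_right[THEN bounded_linear_compose]
          bounded_linear_Re bounded_linear_Im)
    have "(G' ?z \<circ> T' ?z) h = id h" for h
    proof -
      have "(1 + g ?z) * (fst h + (fst h * e ?z + snd h * f ?z)) -
          f ?z * (snd h + (fst h * f ?z + snd h * g ?z)) = fst h * S ?z"
        unfolding SD by (simp add: algebra_simps power2_eq_square)
      moreover have "(1 + e ?z) * (snd h + (fst h * f ?z + snd h * g ?z)) -
          f ?z * (fst h + (fst h * e ?z + snd h * f ?z)) = snd h * S ?z"
        unfolding SD by (simp add: algebra_simps power2_eq_square)
      ultimately show ?thesis
        using S[of ?z] by (simp add: G'_def T'_def prod_eq_iff)
    qed
    then show "G' ?z \<circ> T' ?z = id" by blast
  qed
  define k where "k z = (complex_of_real (g z - e z) + \<i> * complex_of_real (2 * f z)) / complex_of_real (S z)" for z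
  \<comment> \<open>These are the Cauchy-Riemann equations: the differential of \<open>H\<close>
    after \<open>G\<close> is multiplication by a complex number. The condition \<open>det\<close>
    is what makes both components fit.\<close>
  have HG: "H' z (G' z \<zeta>) = k z * \<zeta>" for z \<zeta>
  proof -
    have 1: "(1 - e z) * ((1 + g z) * Re \<zeta> - f z * Im \<zeta>) - f z * ((1 + e z) * Im \<zeta> - f z * Re \<zeta>)
        = (g z - e z) * Re \<zeta> - 2 * f z * Im \<zeta>"
    proof -
      have "(1 - e z) * ((1 + g z) * Re \<zeta> - f z * Im \<zeta>) - f z * ((1 + e z) * Im \<zeta> - f z * Re \<zeta>)
        = (1 + g z - e z - (e z * g z - (f z)\<^sup>2)) * Re \<zeta> - 2 * f z * Im \<zeta>"
        by (simp add: algebra_simps power2_eq_square)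
      then show ?thesis by (simp only: det) simp
    qed
    have 2: "f z * ((1 + g z) * Re \<zeta> - f z * Im \<zeta>) + (g z - 1) * ((1 + e z) * Im \<zeta> - f z * Re \<zeta>)
        = (g z - e z) * Im \<zeta> + 2 * f z * Re \<zeta>"
    proof -
      have "f z * ((1 + g z) * Re \<zeta> - f z * Im \<zeta>) + (g z - 1) * ((1 + e z) * Im \<zeta> - f z * Re \<zeta>)
        = (g z - e z - 1 + (e z * g z - (f z)\<^sup>2)) * Im \<zeta> + 2 * f z * Re \<zeta>"
        by (simp add: algebra_simps power2_eq_square)
      then show ?thesis by (simp only: det) simp
    qed
    have "H' z (G' z \<zeta>) = Complex
       (((1 - e z) * ((1 + g z) * Re \<zeta> - f z * Im \<zeta>) - f z * ((1 + e z) * Im \<zeta> - f z * Re \<zeta>)) / S z)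
       ((f z * ((1 + g z) * Re \<zeta> - f z * Im \<zeta>) + (g z - 1) * ((1 + e z) * Im \<zeta> - f z * Re \<zeta>)) / S z)"
      using S[of z] by (simp add: H'_def G'_def complex_eq_iff field_simps)
    also have "\<dots> = k z * \<zeta>"
      unfolding 1 2 k_def using S[of z]
      by (simp add: complex_eq_iff Re_divide_of_real Im_divide_of_real field_simps)
    finally show ?thesis .
  qed
  have dW: "((\<lambda>\<zeta>. H (G \<zeta>)) has_field_derivative k (G \<zeta>)) (at \<zeta>)" for \<zeta>
    unfolding has_field_derivative_def
    by (rule has_derivative_eq_rhs, rule has_derivative_compose[OF G H]) (simp add: HG)
  then have "(\<lambda>\<zeta>. H (G \<zeta>)) holomorphic_on UNIV"
    by (auto simp: holomorphic_on_def field_differentiable_def intro: has_field_derivative_at_within)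
  then have "deriv (\<lambda>\<zeta>. H (G \<zeta>)) holomorphic_on UNIV"
    by (rule holomorphic_deriv) simp
  moreover have "deriv (\<lambda>\<zeta>. H (G \<zeta>)) = (\<lambda>\<zeta>. k (G \<zeta>))"
    by (rule ext) (rule DERIV_imp_deriv[OF dW])
  ultimately have holk: "(\<lambda>\<zeta>. k (G \<zeta>)) holomorphic_on UNIV" by simp
  \<comment> \<open>In other words |k|^2 = 1 - 4/S. This bounds \<open>k\<close> for Liouville's
    theorem and later recovers \<open>S\<close> from \<open>k\<close>.\<close>
  have kS: "(cmod (k z))\<^sup>2 = (S z - 4) / S z" for z
  proof -
    have "(cmod (k z))\<^sup>2 = ((g z - e z)\<^sup>2 + (2 * f z)\<^sup>2) / (S z)\<^sup>2"
      by (simp add: k_def norm_divide power_divide cmod_power2)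
    also have "(g z - e z)\<^sup>2 + (2 * f z)\<^sup>2 = (g z + e z)\<^sup>2 - 4 * (e z * g z - (f z)\<^sup>2)"
      by (simp add: power2_eq_square algebra_simps)
    also have "\<dots> = (S z - 4) * S z"
      unfolding det by (simp add: S_def power2_eq_square algebra_simps)
    also have "\<dots> / (S z)\<^sup>2 = (S z - 4) / S z"
      using S[of z] by (simp add: power2_eq_square)
    finally show ?thesis .
  qed
  have "cmod (k z) \<le> 1" for z
  proof (rule power2_le_imp_le)
    show "(cmod (k z))\<^sup>2 \<le> 1\<^sup>2"
      unfolding kS using S[of z] by simp
  qed simp
  then have "bounded (range (\<lambda>\<zeta>. k (G \<zeta>)))"
    unfolding bounded_iff by blast
  then have "(\<lambda>\<zeta>. k (G \<zeta>)) constant_on UNIV"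
    by (rule Liouville_theorem[OF holk])
  then obtain k0 where "\<And>\<zeta>. k (G \<zeta>) = k0" unfolding constant_on_def by auto
  moreover have "G (T z) = z" for z using bij by (simp add: G_def bij_is_inj)
  ultimately have k0: "k z = k0" for z by metis
  \<comment> \<open>The modulus of the constant \<open>k0\<close> fixes \<open>S\<close>, hence the
    sum of \<open>e\<close> and \<open>g\<close>; its real and imaginary parts then fix
    \<open>g z - e z\<close> and \<open>f z\<close>. The denominator is nonzero because its product
    with \<open>S z\<close> is 4.\<close>
  have S0: "S z = 4 / (1 - (cmod k0)\<^sup>2)" for z
  proof -
    have "S z * (1 - (cmod k0)\<^sup>2) = 4"
      using kS[of z] S[of z] unfolding k0 by (simp add: field_simps)
    then show ?thesis by (metis mult_zero_right nonzero_eq_divide_eq zero_neq_numeral)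
  qed
  define S0 where "S0 = 4 / (1 - (cmod k0)\<^sup>2)"
  have "e z = (S0 - 2 - S0 * Re k0) / 2" "f z = S0 * Im k0 / 2" "g z = (S0 - 2 + S0 * Re k0) / 2" for z
  proof -
    have "k z * complex_of_real (S z) = complex_of_real (g z - e z) + \<i> * complex_of_real (2 * f z)"
      using S[of z] by (simp add: k_def)
    then have "Re k0 * S0 = g z - e z" "Im k0 * S0 = 2 * f z"
      unfolding k0 S0[of z, folded S0_def] by (auto simp: complex_eq_iff)
    moreover have "2 + e z + g z = S0"
      using S0[of z] by (simp add: S_def S0_def)
    ultimately show "e z = (S0 - 2 - S0 * Re k0) / 2" "f z = S0 * Im k0 / 2"
        "g z = (S0 - 2 + S0 * Re k0) / 2"
      by argo+
  qed
  then show thesis by (rule that)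
qed

section \<open>Constant coefficients: harmonic functions and Picard's theorem\<close>

lemma has_derivative_affine_coordinates:
  fixes v :: "real \<times> real \<Rightarrow> real"
  assumes "\<And>z. (v has_derivative (\<lambda>h. fst h * vx z + snd h * vy z)) (at z)"
  shows "((\<lambda>\<zeta>. v (g * Re \<zeta>, Im \<zeta> - f * Re \<zeta>)) has_derivative
      (\<lambda>h. Re h * (g * vx (g * Re \<zeta>, Im \<zeta> - f * Re \<zeta>) - f * vy (g * Re \<zeta>, Im \<zeta> - f * Re \<zeta>))
           + Im h * vy (g * Re \<zeta>, Im \<zeta> - f * Re \<zeta>))) (at \<zeta>)"
proof -
  have "((\<lambda>\<zeta>. (g * Re \<zeta>, Im \<zeta> - f * Re \<zeta>)) has_derivative (\<lambda>h. (g * Re h, Im h - f * Re h))) (at \<zeta>)"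
    by (auto intro!: derivative_eq_intros)
  then show ?thesis
    by (rule has_derivative_eq_rhs[OF has_derivative_compose[OF _ assms]]) (auto simp: algebra_simps)
qed

text \<open>For \<open>u\<close> with gradient \<open>(p, q)\<close>, the equation becomes the Laplace equation in the
  coordinates \<open>x = g s\<close>, \<open>y = t - f s\<close>, so \<open>u\<^sub>s - \<i> u\<^sub>t\<close> is an entire function of \<open>s + \<i> t\<close>; if \<open>p\<close> or \<open>q\<close> omits a value,
  this function omits a whole line.\<close>

lemma constant_gradient_if_omits_value:
  fixes p q :: "real \<times> real \<Rightarrow> real"
  assumes p: "\<And>z. (p has_derivative (\<lambda>h. fst h * r z + snd h * s z)) (at z)"
    and q: "\<And>z. (q has_derivative (\<lambda>h. fst h * s z + snd h * t z)) (at z)"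
    and eq: "\<And>z. g * r z - 2 * f * s z + e * t z = 0"
    and pos: "g > 0" and det: "e * g - f\<^sup>2 = 1"
    and omit: "c \<notin> range p \<or> c \<notin> range q"
  obtains p0 q0 where "\<And>z. p z = p0" "\<And>z. q z = q0"
proof -
  define L where "L \<zeta> = (g * Re \<zeta>, Im \<zeta> - f * Re \<zeta>)" for \<zeta>
  \<comment> \<open>By the chain rule, \<open>g * p - f * q\<close> and \<open>q\<close> are the
    derivatives of \<open>u\<close> along the real and imaginary parts of \<zeta>.\<close>
  define \<psi> where "\<psi> \<zeta> = complex_of_real (g * p (L \<zeta>) - f * q (L \<zeta>)) - \<i> * complex_of_real (q (L \<zeta>))" for \<zeta>
  define \<psi>' where "\<psi>' \<zeta> = complex_of_real (g * (g * r (L \<zeta>) - f * s (L \<zeta>)) - f * (g * s (L \<zeta>) - f * t (L \<zeta>)))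
     - \<i> * complex_of_real (g * s (L \<zeta>) - f * t (L \<zeta>))" for \<zeta>
  \<comment> \<open>The left-hand side is the second derivative of \<open>u\<close> along Re
    \<zeta>, and \<open>t z\<close> the one along Im \<zeta>. The other Cauchy-Riemann equation is
    the symmetry of mixed derivatives.\<close>
  have CR: "g * (g * r z - f * s z) - f * (g * s z - f * t z) = - t z" for z
  proof -
    have "g * (g * r z - f * s z) - f * (g * s z - f * t z) =
        g * (g * r z - 2 * f * s z + e * t z) - (e * g - f\<^sup>2) * t z"
      by (simp add: algebra_simps power2_eq_square)
    then show ?thesis by (simp add: eq det)
  qed
  note dp = has_derivative_affine_coordinates[OF p, of g f, folded L_def]
  note dq = has_derivative_affine_coordinates[OF q, of g f, folded L_def]
  have "(\<psi> has_field_derivative \<psi>' \<zeta>) (at \<zeta>)" for \<zeta>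
    unfolding has_field_derivative_def \<psi>_def
  proof (rule has_derivative_eq_rhs, (rule derivative_intros dp dq)+, rule ext)
    fix h
    show "complex_of_real (g * (Re h * (g * r (L \<zeta>) - f * s (L \<zeta>)) + Im h * s (L \<zeta>)) -
             f * (Re h * (g * s (L \<zeta>) - f * t (L \<zeta>)) + Im h * t (L \<zeta>))) -
         \<i> * complex_of_real (Re h * (g * s (L \<zeta>) - f * t (L \<zeta>)) + Im h * t (L \<zeta>)) = \<psi>' \<zeta> * h"
    proof -
      have "g * (Re h * (g * r (L \<zeta>) - f * s (L \<zeta>)) + Im h * s (L \<zeta>)) -
             f * (Re h * (g * s (L \<zeta>) - f * t (L \<zeta>)) + Im h * t (L \<zeta>))
         = Re h * (- t (L \<zeta>)) + Im h * (g * s (L \<zeta>) - f * t (L \<zeta>))"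
        unfolding CR[of "L \<zeta>", symmetric] by (simp add: algebra_simps)
      then show ?thesis
        unfolding \<psi>'_def CR by (simp add: complex_eq_iff algebra_simps)
    qed
  qed
  then have hol: "\<psi> holomorphic_on UNIV"
    by (auto simp: holomorphic_on_def field_differentiable_def intro: has_field_derivative_at_within)
  have "\<exists>a b. a \<noteq> b \<and> range \<psi> \<inter> {a, b} = {}"
    using omit
  proof
    assume "c \<notin> range q"
    \<comment> \<open>The imaginary part of \<open>\<psi>\<close> is minus \<open>q\<close>, so the
      horizontal line at height \<open>- c\<close> is omitted; Picard's theorem asks for two of its
      points.\<close>
    then have "Complex 0 (- c) \<noteq> \<psi> \<zeta>" "Complex 1 (- c) \<noteq> \<psi> \<zeta>" for \<zeta>
      by (auto simp: \<psi>_def complex_eq_iff)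
    then have "range \<psi> \<inter> {Complex 0 (- c), Complex 1 (- c)} = {}"
      by (simp add: image_iff)
    moreover have "Complex 0 (- c) \<noteq> Complex 1 (- c)" by simp
    ultimately show ?thesis by metis
  next
    assume c: "c \<notin> range p"
    \<comment> \<open>This combination of real and imaginary part recovers \<open>g * p\<close>, so
      an omitted value of \<open>p\<close> yields an omitted slanted line. The two points below lie
      on it.\<close>
    have ne: "Re (\<psi> \<zeta>) - f * Im (\<psi> \<zeta>) \<noteq> g * c" for \<zeta>
      using c pos by (auto simp: \<psi>_def)
    have "Complex (g * c) 0 \<noteq> \<psi> \<zeta>" "Complex (g * c + f) 1 \<noteq> \<psi> \<zeta>" for \<zeta>
      using ne[of \<zeta>] by (auto simp: complex_eq_iff)
    then have "range \<psi> \<inter> {Complex (g * c) 0, Complex (g * c + f) 1} = {}"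
      by (simp add: image_iff)
    moreover have "Complex (g * c) 0 \<noteq> Complex (g * c + f) 1" by simp
    ultimately show ?thesis by metis
  qed
  then obtain a b where "a \<noteq> b" "range \<psi> \<inter> {a, b} = {}" by blast
  then obtain k where k: "\<psi> = (\<lambda>_. k)" by (rule little_Picard[OF hol])
  \<comment> \<open>An explicit preimage under the change of coordinates, which carries the
    constancy of \<open>\<psi>\<close> over to every \<open>z\<close>.\<close>
  have L: "L (Complex (fst z / g) (snd z + f * fst z / g)) = z" for z
    using pos by (simp add: L_def)
  have q0: "q z = - Im k" for z
    using arg_cong[OF k, of "\<lambda>\<psi>. Im (\<psi> (Complex (fst z / g) (snd z + f * fst z / g)))"]
    by (simp add: \<psi>_def L)
  have "p z = (Re k - f * Im k) / g" for z
    using arg_cong[OF k, of "\<lambda>\<psi>. Re (\<psi> (Complex (fst z / g) (snd z + f * fst z / g)))"] pos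
    by (simp add: \<psi>_def L q0) (simp add: field_simps)
  then show thesis using q0 by (rule that)
qed

section \<open>Partial derivatives of maps on the plane\<close>

lemma partial_eqI:
  fixes f :: "real \<times> real \<Rightarrow> 'e::real_normed_vector"
  assumes "(f has_derivative (\<lambda>h. fst h *\<^sub>R a + snd h *\<^sub>R b)) (at z)"
  shows "partial_x f z = a" "partial_y f z = b"
proof -
  obtain x y where z: "z = (x, y)" by fastforce
  have "((\<lambda>t. f (t, y)) has_derivative (\<lambda>h. h *\<^sub>R a)) (at x)"
    by (rule has_derivative_eq_rhs, rule has_derivative_compose[of "\<lambda>x. (x, y)" "\<lambda>h. (h, 0)" x UNIV f])
       (use assms z in \<open>auto intro!: derivative_eq_intros\<close>)
  then show "partial_x f z = a"
    by (simp add: partial_x_def z vector_derivative_at has_vector_derivative_def)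
  have "((\<lambda>t. f (x, t)) has_derivative (\<lambda>h. h *\<^sub>R b)) (at y)"
    by (rule has_derivative_eq_rhs, rule has_derivative_compose[of "\<lambda>y. (x, y)" "\<lambda>h. (0, h)" y UNIV f])
       (use assms z in \<open>auto intro!: derivative_eq_intros\<close>)
  then show "partial_y f z = b"
    by (simp add: partial_y_def z vector_derivative_at has_vector_derivative_def)
qed

lemma blinfun_plane_decomp:
  "blinfun_apply (A :: (real \<times> real) \<Rightarrow>\<^sub>L 'e::real_normed_vector) h =
     fst h *\<^sub>R A (1, 0) + snd h *\<^sub>R A (0, 1)"
proof -
  have "h = fst h *\<^sub>R (1, 0) + snd h *\<^sub>R (0, 1)" by (simp add: prod_eq_iff)
  then have "A h = A (fst h *\<^sub>R (1, 0) + snd h *\<^sub>R (0, 1))" by simp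
  then show ?thesis by (simp only: blinfun.bilinear_simps)
qed

lemma has_derivative_plane_component:
  fixes f :: "real \<times> real \<Rightarrow> real ^ 'n"
  assumes "(f has_derivative (\<lambda>h. fst h *\<^sub>R a + snd h *\<^sub>R b)) F"
  shows "((\<lambda>z. f z $ k) has_derivative (\<lambda>h. fst h * (a $ k) + snd h * (b $ k))) F"
  using bounded_linear.has_derivative[OF bounded_linear_vec_nth assms, of k] by simp

text \<open>The single \<open>s\<close> in the derivatives of both \<open>p\<close> and
  \<open>q\<close> is Schwarz's theorem, applied to each real component.\<close>

lemma C2_map_partials:
  fixes f :: "real \<times> real \<Rightarrow> real ^ 'n"
  assumes "C2_map f"
  obtains p q r s t where
    "\<And>z. (f has_derivative (\<lambda>h. fst h *\<^sub>R p z + snd h *\<^sub>R q z)) (at z)"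
    "\<And>z. (p has_derivative (\<lambda>h. fst h *\<^sub>R r z + snd h *\<^sub>R s z)) (at z)"
    "\<And>z. (q has_derivative (\<lambda>h. fst h *\<^sub>R s z + snd h *\<^sub>R t z)) (at z)"
    "continuous_on UNIV r" "continuous_on UNIV s" "continuous_on UNIV t"
proof -
  obtain f' :: "real \<times> real \<Rightarrow> (real \<times> real) \<Rightarrow>\<^sub>L (real ^ 'n)"
    and f'' :: "real \<times> real \<Rightarrow> (real \<times> real) \<Rightarrow>\<^sub>L ((real \<times> real) \<Rightarrow>\<^sub>L (real ^ 'n))"
    where f': "\<And>z. (f has_derivative f' z) (at z)" and f'': "\<And>z. (f' has_derivative f'' z) (at z)"
      and cont: "continuous_on UNIV f''"
    using assms unfolding C2_map_def C1_map_def by metis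
  define p where "p z = f' z (1, 0)" for z
  define q where "q z = f' z (0, 1)" for z
  define r where "r z = f'' z (1, 0) (1, 0)" for z
  \<comment> \<open>The first argument of \<open>f'' z\<close> is the direction of the later
    differentiation, so \<open>s\<close> is the derivative of \<open>p\<close> in y and
    \<open>s'\<close> that of \<open>q\<close> in x.\<close>
  define s where "s z = f'' z (0, 1) (1, 0)" for z
  define s' where "s' z = f'' z (1, 0) (0, 1)" for z
  define t where "t z = f'' z (0, 1) (0, 1)" for z
  have f: "(f has_derivative (\<lambda>h. fst h *\<^sub>R p z + snd h *\<^sub>R q z)) (at z)" for z
    using f'[of z] unfolding p_def q_def blinfun_plane_decomp[of "f' z", symmetric] .
  have D: "((\<lambda>z. f' z v) has_derivative (\<lambda>h. fst h *\<^sub>R f'' z (1, 0) v + snd h *\<^sub>R f'' z (0, 1) v)) (at z)" for z v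
    using bounded_linear.has_derivative[OF blinfun.bounded_linear_left f'', of v z]
    by (rule has_derivative_eq_rhs)
       (subst blinfun_plane_decomp, simp add: blinfun.bilinear_simps)
  have p: "(p has_derivative (\<lambda>h. fst h *\<^sub>R r z + snd h *\<^sub>R s z)) (at z)" for z
    unfolding p_def r_def s_def by (rule D)
  have q: "(q has_derivative (\<lambda>h. fst h *\<^sub>R s' z + snd h *\<^sub>R t z)) (at z)" for z
    unfolding q_def s'_def t_def by (rule D)
  have conts: "continuous_on UNIV r" "continuous_on UNIV s" "continuous_on UNIV s'" "continuous_on UNIV t"
    unfolding r_def s_def s'_def t_def using cont by (intro continuous_intros; assumption)+
  have "s z = s' z" for z
    unfolding vec_eq_iff
    using mixed_partials_eq[OF has_derivative_plane_component[OF f]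
        has_derivative_plane_component[OF p] has_derivative_plane_component[OF q]
        continuous_on_component[OF conts(2)] continuous_on_component[OF conts(3)]]
    by blast
  then have "s' = s" by (auto simp: fun_eq_iff)
  then show thesis using that f p q conts by blast
qed

section \<open>The minimal surface equation for graphs\<close>

text \<open>\<open>normal_part\<close> is a definite description, so existence and uniqueness of the
  orthogonal decomposition must be shown before anything can be read off from it.\<close>

lemma diff_normal_part_in_tangent_space: "v - normal_part X p v \<in> tangent_space X p"
proof -
  let ?S = "tangent_space X p"
  have sub: "subspace ?S" by (simp add: tangent_space_def)
  obtain a b where ab: "a \<in> ?S" "\<And>w. w \<in> ?S \<Longrightarrow> orthogonal b w" "v = a + b"
    using orthogonal_subspace_decomp_exists[of ?S v] sub by (metis span_eq_iff)
  have "\<exists>!w. w \<in> ?S\<^sup>\<bottom> \<and> v - w \<in> ?S"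
  proof (rule ex1I[of _ b])
    show "b \<in> ?S\<^sup>\<bottom> \<and> v - b \<in> ?S"
      using ab by (auto simp: orthogonal_comp_def orthogonal_commute)
  next
    fix w assume w: "w \<in> ?S\<^sup>\<bottom> \<and> v - w \<in> ?S"
    have "b - w = (v - w) - a" using ab by simp
    then have "b - w \<in> ?S" using w ab sub by (metis subspace_diff)
    then have "orthogonal b (b - w)" "orthogonal w (b - w)"
      using w ab(2) by (auto simp: orthogonal_comp_def orthogonal_commute[of w])
    then have "(b - w) \<bullet> (b - w) = 0"
      by (simp add: orthogonal_def inner_diff_left)
    then show "w = b" by simp
  qed
  from theI'[OF this] show ?thesis unfolding normal_part_def by blast
qed

text \<open>Vanishing mean curvature puts the combination of second derivatives of the graph map
  into the tangent space. That combination has zero horizontal component, and a tangent vector of a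
  graph is determined by its horizontal component.\<close>

lemma minimal_graph_equation:
  fixes f :: "real \<times> real \<Rightarrow> 'e::euclidean_space"
  assumes "minimal_surface (graph_map f)"
    and f: "\<And>z. (f has_derivative (\<lambda>h. fst h *\<^sub>R p z + snd h *\<^sub>R q z)) (at z)"
    and p: "\<And>z. (p has_derivative (\<lambda>h. fst h *\<^sub>R r z + snd h *\<^sub>R s z)) (at z)"
    and q: "\<And>z. (q has_derivative (\<lambda>h. fst h *\<^sub>R s z + snd h *\<^sub>R t z)) (at z)"
  shows "(1 + q z \<bullet> q z) *\<^sub>R r z - (2 * (p z \<bullet> q z)) *\<^sub>R s z + (1 + p z \<bullet> p z) *\<^sub>R t z = 0"
proof -
  define X where "X = graph_map f"
  have "(X has_derivative (\<lambda>h. fst h *\<^sub>R ((1, 0), p z) + snd h *\<^sub>R ((0, 1), q z))) (at z)" for z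
    unfolding X_def graph_map_def
    by (rule has_derivative_eq_rhs, (rule derivative_intros f)+) (auto simp: fun_eq_iff)
  from partial_eqI[OF this]
  have X: "partial_x X = (\<lambda>z. ((1, 0), p z))" "partial_y X = (\<lambda>z. ((0, 1), q z))" by auto
  have "(partial_x X has_derivative (\<lambda>h. fst h *\<^sub>R (0, r z) + snd h *\<^sub>R (0, s z))) (at z)" for z
    unfolding X by (rule has_derivative_eq_rhs, (rule derivative_intros p)+) (auto simp: fun_eq_iff zero_prod_def)
  from partial_eqI[OF this] have XX: "partial_x (partial_x X) z = (0, r z)" for z by auto
  have "(partial_y X has_derivative (\<lambda>h. fst h *\<^sub>R (0, s z) + snd h *\<^sub>R (0, t z))) (at z)" for z
    unfolding X by (rule has_derivative_eq_rhs, (rule derivative_intros q)+) (auto simp: fun_eq_iff zero_prod_def)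
  from partial_eqI[OF this] have XY: "partial_x (partial_y X) z = (0, s z)"
    "partial_y (partial_y X) z = (0, t z)" for z by auto
  define E where "E = 1 + p z \<bullet> p z"
  define F where "F = p z \<bullet> q z"
  define G where "G = 1 + q z \<bullet> q z"
  have "F\<^sup>2 \<le> (p z \<bullet> p z) * (q z \<bullet> q z)" unfolding F_def by (rule Cauchy_Schwarz_ineq)
  \<comment> \<open>Positivity allows the scalar factor in the mean curvature vector to be
    cancelled.\<close>
  then have "E * G - F\<^sup>2 > 0"
    unfolding E_def G_def by (simp add: algebra_simps add_pos_nonneg add_nonneg_pos)
      (smt (verit) inner_ge_zero)
  moreover have "mean_curvature_vector X z = 0"
    using assms(1) unfolding minimal_surface_def X_def by blast
  ultimately have H: "G *\<^sub>R normal_part X z (0, r z) - (2 * F) *\<^sub>R normal_part X z (0, s z)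
      + E *\<^sub>R normal_part X z (0, t z) = 0"
    unfolding mean_curvature_vector_def Let_def XX XY unfolding X by (simp add: E_def F_def G_def)
  let ?S = "tangent_space X z"
  have sub: "subspace ?S" by (simp add: tangent_space_def)
  let ?d = "\<lambda>v. v - normal_part X z v"
  have "G *\<^sub>R ?d (0, r z) - (2 * F) *\<^sub>R ?d (0, s z) + E *\<^sub>R ?d (0, t z) \<in> ?S"
    by (intro subspace_add subspace_diff subspace_scale sub diff_normal_part_in_tangent_space)
  moreover have "G *\<^sub>R ?d (0, r z) - (2 * F) *\<^sub>R ?d (0, s z) + E *\<^sub>R ?d (0, t z) =
     (0, G *\<^sub>R r z - (2 * F) *\<^sub>R s z + E *\<^sub>R t z) -
     (G *\<^sub>R normal_part X z (0, r z) - (2 * F) *\<^sub>R normal_part X z (0, s z)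
      + E *\<^sub>R normal_part X z (0, t z))"
    by (simp add: algebra_simps)
  ultimately have "(0, G *\<^sub>R r z - (2 * F) *\<^sub>R s z + E *\<^sub>R t z) \<in> ?S"
    using H by simp
  then obtain \<alpha> \<beta> where
    "(0, G *\<^sub>R r z - (2 * F) *\<^sub>R s z + E *\<^sub>R t z) -
     \<alpha> *\<^sub>R ((1, 0) :: real \<times> real, p z) - \<beta> *\<^sub>R ((0, 1), q z) = 0"
    unfolding tangent_space_def X span_insert span_empty by blast
  then have "\<alpha> = 0" "\<beta> = 0"
    "G *\<^sub>R r z - (2 * F) *\<^sub>R s z + E *\<^sub>R t z = \<alpha> *\<^sub>R p z + \<beta> *\<^sub>R q z"
    by (auto simp: prod_eq_iff algebra_simps)
  then show ?thesis by (simp add: E_def F_def G_def)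
qed

section \<open>Divergence form of the minimal surface equation\<close>

lemma has_derivative_divide_sqrt:
  fixes X d :: "'a::real_normed_vector \<Rightarrow> real"
  assumes X: "(X has_derivative X') (at z)" and d: "(d has_derivative d') (at z)" and "d z > 0"
  shows "((\<lambda>z. X z / sqrt (d z)) has_derivative
     (\<lambda>h. (X' h * d z - X z * d' h / 2) / (d z * sqrt (d z)))) (at z)"
proof -
  have "sqrt (d z) > 0" using assms by simp
  moreover have "sqrt (d z) * sqrt (d z) = d z" using assms by simp
  ultimately show ?thesis
    by (intro has_derivative_eq_rhs[OF has_derivative_divide[OF X has_derivative_compose[OF d
          has_field_derivative_imp_has_derivative[OF DERIV_real_sqrt[OF assms(3)]]]]])
       (auto simp: fun_eq_iff field_simps)
qed

text \<open>The rows of the normalized metric are closed forms, as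
  \<open>entire_unimodular_hessian_constant\<close> requires. Here \<open>W\<close> is the
  determinant itself, not its square root.\<close>

lemma minimal_graph_divergence_form:
  fixes p q r s t :: "real \<times> real \<Rightarrow> 'v::real_inner"
  assumes p: "\<And>z. (p has_derivative (\<lambda>h. fst h *\<^sub>R r z + snd h *\<^sub>R s z)) (at z)"
    and q: "\<And>z. (q has_derivative (\<lambda>h. fst h *\<^sub>R s z + snd h *\<^sub>R t z)) (at z)"
    and cont: "continuous_on UNIV r" "continuous_on UNIV s" "continuous_on UNIV t"
    and eq: "\<And>z. (1 + q z \<bullet> q z) *\<^sub>R r z - (2 * (p z \<bullet> q z)) *\<^sub>R s z + (1 + p z \<bullet> p z) *\<^sub>R t z = 0"
    and E: "\<And>z. E z = 1 + p z \<bullet> p z" and F: "\<And>z. F z = p z \<bullet> q z" and G: "\<And>z. G z = 1 + q z \<bullet> q z"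
    and W: "\<And>z. W z = E z * G z - (F z)\<^sup>2"
  obtains ex c d gy where
    "\<And>z. ((\<lambda>z. E z / sqrt (W z)) has_derivative (\<lambda>h. fst h * ex z + snd h * c z)) (at z)"
    "\<And>z. ((\<lambda>z. F z / sqrt (W z)) has_derivative (\<lambda>h. fst h * c z + snd h * d z)) (at z)"
    "\<And>z. ((\<lambda>z. G z / sqrt (W z)) has_derivative (\<lambda>h. fst h * d z + snd h * gy z)) (at z)"
    "continuous_on UNIV ex" "continuous_on UNIV c" "continuous_on UNIV d" "continuous_on UNIV gy"
    "\<And>z. W z > 0"
proof -
  have Wpos: "W z > 0" for z
  proof -
    have "(F z)\<^sup>2 \<le> (p z \<bullet> p z) * (q z \<bullet> q z)" unfolding F by (rule Cauchy_Schwarz_ineq)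
    then show ?thesis
      unfolding W E G by (simp add: algebra_simps) (smt (verit) inner_ge_zero)
  qed
  define Ex Ey Fx Fy Gx Gy where "Ex z = 2 * (p z \<bullet> r z)" "Ey z = 2 * (p z \<bullet> s z)"
    "Fx z = q z \<bullet> r z + p z \<bullet> s z" "Fy z = q z \<bullet> s z + p z \<bullet> t z"
    "Gx z = 2 * (q z \<bullet> s z)" "Gy z = 2 * (q z \<bullet> t z)" for z
  note partials = this
  have DE: "(E has_derivative (\<lambda>h. fst h * Ex z + snd h * Ey z)) (at z)" for z
    unfolding E[abs_def] partials
    by (rule has_derivative_eq_rhs, (rule derivative_intros p)+)
       (auto simp: fun_eq_iff inner_simps inner_commute algebra_simps)
  have DF: "(F has_derivative (\<lambda>h. fst h * Fx z + snd h * Fy z)) (at z)" for z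
    unfolding F[abs_def] partials
    by (rule has_derivative_eq_rhs, (rule derivative_intros p q)+)
       (auto simp: fun_eq_iff inner_simps inner_commute algebra_simps)
  have DG: "(G has_derivative (\<lambda>h. fst h * Gx z + snd h * Gy z)) (at z)" for z
    unfolding G[abs_def] partials
    by (rule has_derivative_eq_rhs, (rule derivative_intros q)+)
       (auto simp: fun_eq_iff inner_simps inner_commute algebra_simps)
  define Wx where "Wx z = Ex z * G z + E z * Gx z - 2 * F z * Fx z" for z
  define Wy where "Wy z = Ey z * G z + E z * Gy z - 2 * F z * Fy z" for z
  have DW: "(W has_derivative (\<lambda>h. fst h * Wx z + snd h * Wy z)) (at z)" for z
    unfolding W[abs_def] Wx_def Wy_def
    by (rule has_derivative_eq_rhs, (rule derivative_intros DE DF DG)+)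
       (auto simp: fun_eq_iff algebra_simps)
  define Q where "Q X X' W' z = (X' z * W z - X z * W' z / 2) / (W z * sqrt (W z))"
    for X X' W' :: "real \<times> real \<Rightarrow> real" and z
  have DQ: "((\<lambda>z. X z / sqrt (W z)) has_derivative (\<lambda>h. fst h * Q X Xx Wx z + snd h * Q X Xy Wy z)) (at z)"
    if "\<And>z. (X has_derivative (\<lambda>h. fst h * Xx z + snd h * Xy z)) (at z)" for X Xx Xy z
    by (rule has_derivative_eq_rhs[OF has_derivative_divide_sqrt[OF that DW Wpos]])
       (auto simp: Q_def fun_eq_iff add_divide_distrib diff_divide_distrib algebra_simps)
  have contpq: "continuous_on UNIV p" "continuous_on UNIV q"
    using p q by (meson has_derivative_continuous continuous_at_imp_continuous_on)+
  have conts: "continuous_on UNIV E" "continuous_on UNIV F" "continuous_on UNIV G"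
    "continuous_on UNIV Ex" "continuous_on UNIV Ey" "continuous_on UNIV Fx" "continuous_on UNIV Fy"
    "continuous_on UNIV Gx" "continuous_on UNIV Gy"
    unfolding E[abs_def] F[abs_def] G[abs_def] partials[abs_def]
    by (intro continuous_intros contpq cont)+
  have contW: "continuous_on UNIV W" "continuous_on UNIV Wx" "continuous_on UNIV Wy"
    unfolding W[abs_def] Wx_def[abs_def] Wy_def[abs_def] by (intro continuous_intros conts)+
  have contQ: "continuous_on UNIV (Q X X' W')"
    if "continuous_on UNIV X" "continuous_on UNIV X'" "continuous_on UNIV W'" for X X' W'
  proof -
    have "W z \<noteq> 0" for z using Wpos[of z] by simp
    then show ?thesis
      unfolding Q_def[abs_def] by (intro continuous_intros that contW) simp_all
  qed
  \<comment> \<open>The equation is tested against a vector \<open>v\<close>, below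
    \<open>p z\<close> or \<open>q z\<close>.\<close>
  have eq': "G z * (v \<bullet> r z) - 2 * F z * (v \<bullet> s z) + E z * (v \<bullet> t z) = 0" for z v
    using arg_cong[OF eq[of z], of "\<lambda>w. v \<bullet> w"] by (simp add: inner_simps E F G)
  have "Q E Ey Wy z = Q F Fx Wx z" for z
  proof -
    \<comment> \<open>With the common denominator removed, the difference of the two cross
      derivatives is a combination of the equations tested with \<open>p z\<close> and
      \<open>q z\<close>.\<close>
    have "(Ey z * W z - E z * Wy z / 2) - (Fx z * W z - F z * Wx z / 2) =
        F z * (G z * (p z \<bullet> r z) - 2 * F z * (p z \<bullet> s z) + E z * (p z \<bullet> t z)) -
        E z * (G z * (q z \<bullet> r z) - 2 * F z * (q z \<bullet> s z) + E z * (q z \<bullet> t z))"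
      unfolding Wx_def Wy_def W partials by (simp add: field_simps power2_eq_square)
    then show ?thesis unfolding eq' Q_def by simp
  qed
  then have 1: "Q E Ey Wy = Q F Fx Wx" by (rule ext)
  have "Q F Fy Wy z = Q G Gx Wx z" for z
  proof -
    have "(Fy z * W z - F z * Wy z / 2) - (Gx z * W z - G z * Wx z / 2) =
        G z * (G z * (p z \<bullet> r z) - 2 * F z * (p z \<bullet> s z) + E z * (p z \<bullet> t z)) -
        F z * (G z * (q z \<bullet> r z) - 2 * F z * (q z \<bullet> s z) + E z * (q z \<bullet> t z))"
      unfolding Wx_def Wy_def W partials by (simp add: field_simps power2_eq_square)
    then show ?thesis unfolding eq' Q_def by simp
  qed
  then have 2: "Q F Fy Wy = Q G Gx Wx" by (rule ext)
  show thesis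
    by (rule that[OF DQ[OF DE, unfolded 1] DQ[OF DF, unfolded 2] DQ[OF DG]])
       (intro contQ conts contW Wpos)+
qed

section \<open>Affine components and planar graphs\<close>

lemma constant_derivative_affine:
  fixes f :: "'a::real_normed_vector \<Rightarrow> 'b::real_inner"
  assumes "\<And>z. (f has_derivative A) (at z)"
  shows "f z = A z + f 0"
proof -
  have "\<exists>c. \<forall>z\<in>UNIV. f z - A z = c"
  proof (rule has_derivative_zero_constant[OF convex_UNIV])
    interpret bounded_linear A using assms by (rule has_derivative_bounded_linear)
    have "(A has_derivative A) (at z)" for z by (rule bounded_linear_imp_has_derivative) unfold_locales
    from has_derivative_diff[OF assms this]
    show "((\<lambda>z. f z - A z) has_derivative (\<lambda>_. 0)) (at z within UNIV)" for z by simp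
  qed
  then have "f z - A z = f 0 - A 0" by auto
  moreover have "A 0 = 0" using assms by (metis has_derivative_bounded_linear bounded_linear.linear linear_0)
  ultimately show ?thesis by (simp add: algebra_simps)
qed

text \<open>The graph is a translate of the image of the plane under an injective linear map, which
  preserves dimension.\<close>

lemma is_plane_affine_graph:
  fixes f :: "real \<times> real \<Rightarrow> 'e::euclidean_space"
  assumes "linear A" "\<And>z. f z = A z + b"
  shows "is_plane (range (graph_map f))"
proof -
  have lin: "linear (\<lambda>z. (z, A z))"
    using assms(1) by (simp add: linear_iff)
  have "range (graph_map f) = (+) (0, b) ` range (\<lambda>z. (z, A z))"
    unfolding image_image by (intro image_cong refl) (simp add: graph_map_def assms(2))
  moreover have "affine (range (\<lambda>z. (z, A z)))"
    by (intro subspace_imp_affine linear_subspace_image lin subspace_UNIV)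
  moreover have "aff_dim (range (\<lambda>z. (z, A z))) = 2"
    using aff_dim_injective_linear_image[OF lin, of UNIV] by (simp add: inj_on_def aff_dim_UNIV)
  ultimately show ?thesis
    by (simp add: is_plane_def affine_translation[symmetric] aff_dim_translation_eq)
qed

text \<open>Both claims of the theorem reduce to an omitted value. Minimality of the whole graph
  makes the coefficients constant; the components then decouple, and the \<open>k\<close>-th can be
  treated alone.\<close>

lemma minimal_graph_components:
  fixes f :: "real \<times> real \<Rightarrow> real ^ 'n"
  assumes "C2_map f" and "minimal_surface (graph_map f)"
    and omit: "c \<notin> range (partial_x (\<lambda>q. f q $ k)) \<or> c \<notin> range (partial_y (\<lambda>q. f q $ k))"
  obtains a b where "\<And>z. f z $ k = a * fst z + b * snd z + f 0 $ k"
proof -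
  obtain p q r s t where
    f: "\<And>z. (f has_derivative (\<lambda>h. fst h *\<^sub>R p z + snd h *\<^sub>R q z)) (at z)" and
    p: "\<And>z. (p has_derivative (\<lambda>h. fst h *\<^sub>R r z + snd h *\<^sub>R s z)) (at z)" and
    q: "\<And>z. (q has_derivative (\<lambda>h. fst h *\<^sub>R s z + snd h *\<^sub>R t z)) (at z)" and
    cont: "continuous_on UNIV r" "continuous_on UNIV s" "continuous_on UNIV t"
    using C2_map_partials[OF assms(1)] by blast
  define E where "E z = 1 + p z \<bullet> p z" for z
  define F where "F z = p z \<bullet> q z" for z
  define G where "G z = 1 + q z \<bullet> q z" for z
  define W where "W z = E z * G z - (F z)\<^sup>2" for z
  note eq = minimal_graph_equation[OF assms(2) f p q]
  obtain ex c' d gy where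
    div: "\<And>z. ((\<lambda>z. E z / sqrt (W z)) has_derivative (\<lambda>h. fst h * ex z + snd h * c' z)) (at z)"
    "\<And>z. ((\<lambda>z. F z / sqrt (W z)) has_derivative (\<lambda>h. fst h * c' z + snd h * d z)) (at z)"
    "\<And>z. ((\<lambda>z. G z / sqrt (W z)) has_derivative (\<lambda>h. fst h * d z + snd h * gy z)) (at z)"
    "continuous_on UNIV ex" "continuous_on UNIV c'" "continuous_on UNIV d" "continuous_on UNIV gy"
    and W: "\<And>z. W z > 0"
    using minimal_graph_divergence_form[OF p q cont eq E_def F_def G_def W_def] by blast
  have sqrtW: "sqrt (W z) > 0" for z using W[of z] by simp
  have EG: "E z > 0" "G z > 0" for z
    by (simp_all add: E_def G_def add_pos_nonneg)
  have det: "E z / sqrt (W z) * (G z / sqrt (W z)) - (F z / sqrt (W z))\<^sup>2 = 1" for z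
  proof -
    have "E z / sqrt (W z) * (G z / sqrt (W z)) - (F z / sqrt (W z))\<^sup>2 = (E z * G z - (F z)\<^sup>2) / (sqrt (W z))\<^sup>2"
      by (simp add: power_divide diff_divide_distrib power2_eq_square)
    then show ?thesis using W[of z] by (simp add: W_def)
  qed
  have pos: "E z / sqrt (W z) > 0" for z using EG sqrtW by simp
  obtain e0 f0 g0 where const: "\<And>z. E z / sqrt (W z) = e0" "\<And>z. F z / sqrt (W z) = f0"
      "\<And>z. G z / sqrt (W z) = g0"
    using entire_unimodular_hessian_constant[OF div pos det] by blast
  \<comment> \<open>Division by \<open>sqrt (W z)\<close> replaces the coefficients of the minimal
    surface equation by constants.\<close>
  have pde: "g0 * r z $ k - 2 * f0 * s z $ k + e0 * t z $ k = 0" for z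
  proof -
    have "g0 * r z $ k - 2 * f0 * s z $ k + e0 * t z $ k =
        (G z * r z $ k - 2 * F z * s z $ k + E z * t z $ k) / sqrt (W z)"
      unfolding const[of z, symmetric] by (simp add: add_divide_distrib diff_divide_distrib)
    also have "G z * r z $ k - 2 * F z * s z $ k + E z * t z $ k = 0"
      using arg_cong[OF eq[of z], of "\<lambda>w. w $ k"] by (simp add: E_def F_def G_def)
    finally show ?thesis by simp
  qed
  have g0: "g0 > 0" using EG(2) sqrtW unfolding const(3)[of 0, symmetric] by simp
  have det0: "e0 * g0 - f0\<^sup>2 = 1" using det unfolding const .
  have "((\<lambda>q. f q $ k) has_derivative (\<lambda>h. fst h *\<^sub>R (p z $ k) + snd h *\<^sub>R (q z $ k))) (at z)" for z
    using has_derivative_plane_component[OF f] by simp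
  note fk = partial_eqI[OF this]
  have "partial_x (\<lambda>q. f q $ k) = (\<lambda>z. p z $ k)" "partial_y (\<lambda>q. f q $ k) = (\<lambda>z. q z $ k)"
    by (rule ext, rule fk)+
  then have "c \<notin> range (\<lambda>z. p z $ k) \<or> c \<notin> range (\<lambda>z. q z $ k)" using omit by simp
  from constant_gradient_if_omits_value[OF has_derivative_plane_component[OF p]
      has_derivative_plane_component[OF q] pde g0 det0 this]
  obtain p0 q0 where pq: "\<And>z. p z $ k = p0" "\<And>z. q z $ k = q0"
    by blast
  have "((\<lambda>z. f z $ k) has_derivative (\<lambda>h. p0 * fst h + q0 * snd h)) (at z)" for z
    using has_derivative_plane_component[OF f, of k z] unfolding pq by (simp only: mult.commute)
  then have "f z $ k = p0 * fst z + q0 * snd z + f 0 $ k" for z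
    by (rule constant_derivative_affine)
  then show thesis by (rule that)
qed

theorem theorem8:
  fixes f :: "real \<times> real \<Rightarrow> real ^ 'n"
  assumes "C2_map f"
    and "minimal_surface (graph_map f)"
  shows "((\<forall>k. (\<forall>p. partial_x (\<lambda>q. f q $ k) p > 0) \<or> (\<forall>p. partial_x (\<lambda>q. f q $ k) p < 0) \<or>
               (\<forall>p. partial_y (\<lambda>q. f q $ k) p > 0) \<or> (\<forall>p. partial_y (\<lambda>q. f q $ k) p < 0))
            \<longrightarrow> is_plane (range (graph_map f))) \<and>
         (\<forall>k. (\<exists>c. c \<noteq> 0 \<and> (\<forall>p. partial_x (\<lambda>q. f q $ k) p = c)) \<or>
               (\<exists>c. c \<noteq> 0 \<and> (\<forall>p. partial_y (\<lambda>q. f q $ k) p = c))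
            \<longrightarrow> affine_function (\<lambda>q. f q $ k))"
proof (intro conjI impI allI)
  assume sign: "\<forall>k. (\<forall>p. partial_x (\<lambda>q. f q $ k) p > 0) \<or> (\<forall>p. partial_x (\<lambda>q. f q $ k) p < 0) \<or>
               (\<forall>p. partial_y (\<lambda>q. f q $ k) p > 0) \<or> (\<forall>p. partial_y (\<lambda>q. f q $ k) p < 0)"
  \<comment> \<open>A derivative of one strict sign omits 0.\<close>
  have "0 \<notin> range (partial_x (\<lambda>q. f q $ k)) \<or> 0 \<notin> range (partial_y (\<lambda>q. f q $ k))" for k
    using spec[OF sign, of k] unfolding image_iff by (metis order_less_irrefl)
  then have "\<exists>a b. \<forall>z. f z $ k = a * fst z + b * snd z + f 0 $ k" for k
    using minimal_graph_components[OF assms, of 0 k] by metis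
  then obtain a b where ab: "\<And>z k. f z $ k = a k * fst z + b k * snd z + f 0 $ k" by metis
  show "is_plane (range (graph_map f))"
  proof (rule is_plane_affine_graph)
    show "linear (\<lambda>z. \<chi> k. a k * fst z + b k * snd z)"
      by (rule linearI) (simp_all add: vec_eq_iff algebra_simps)
    show "f z = (\<chi> k. a k * fst z + b k * snd z) + f 0" for z
      unfolding vec_eq_iff by (simp add: ab[of z])
  qed
next
  fix k
  assume "(\<exists>c. c \<noteq> 0 \<and> (\<forall>p. partial_x (\<lambda>q. f q $ k) p = c)) \<or>
          (\<exists>c. c \<noteq> 0 \<and> (\<forall>p. partial_y (\<lambda>q. f q $ k) p = c))"
  then obtain c where "(\<forall>p. partial_x (\<lambda>q. f q $ k) p = c) \<or> (\<forall>p. partial_y (\<lambda>q. f q $ k) p = c)"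
    by blast
  \<comment> \<open>A constant function omits every other value; \<open>c + 1\<close> is
    one.\<close>
  then have "c + 1 \<notin> range (partial_x (\<lambda>q. f q $ k)) \<or> c + 1 \<notin> range (partial_y (\<lambda>q. f q $ k))"
    by auto
  from minimal_graph_components[OF assms this]
  obtain a b where "\<And>z. f z $ k = a * fst z + b * snd z + f 0 $ k"
    by blast
  then show "affine_function (\<lambda>q. f q $ k)"
    unfolding affine_function_def by (metis fst_conv snd_conv)
qed

end
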